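(* Let $X$ be a real normed space, let $\mathcal F$ be a directionally fine family of closed cones in $X$, and let $L,K\subset X$ be cones such that $L\cap K=\{0_X\}$, with $K$ closed and $L$ locally compact. Then there exist a continuous positively homogeneous function $\Phi:X\to\mathbb R$ and $\gamma_L>0$ such that $|\Phi(x)|\le\|x\|$ for every $x\in X$ and \[ \Phi(l)\ge\gamma_L\|l\|>0>\Phi(k)\qquad\forall l\in L\setminus\{0_X\},\ \forall k\in K\setminus\{0_X\}. \]
   Context: $S_X$ is the unit sphere, $B(x,r)=\{y\in X:\|y-x\|\le r\}$, $\operatorname{cone}(A)=\{ta:t\ge0,\ a\in A\}$. A nonempty set $C\subset X$ is a cone if $tC\subset C$ for every $t\ge 0$; all cones are assumed proper, i.e. $\{0_X\}\subsetneq C\subsetneq X$ (not necessarily convex). A family $\mathcal F$ of closed cones in $X$ is directionally fine if for every $u\in S_X$ and $\varepsilon\in(0,1)$ there exists $C\in\mathcal F$ with $u\in\operatorname{int}C\subset C\subset\operatorname{cone}B(u,\varepsilon)$. A cone $L$ is locally compact if for every $x\in L$ there is $r>0$ with $L\cap B(x,r)$ norm compact. A mapping is positively homogeneous if $\Phi(tx)=t\Phi(x)$ for all $t\ge0$, $x\in X$. *)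

theory Defs
  imports "HOL-Analysis.Analysis"
begin

text \<open>Every cone is assumed proper. The library predicate \<^const>\<open>cone\<close> also admits the
  empty set, \<open>{0}\<close> and the whole space; these are excluded here. Convexity is not required.\<close>

definition proper_cone :: "'a::real_vector set \<Rightarrow> bool"
  where "proper_cone C \<longleftrightarrow> cone C \<and> {0} \<subset> C \<and> C \<subset> UNIV"

definition cone_gen :: "'a::real_vector set \<Rightarrow> 'a set"
  where "cone_gen A = {t *\<^sub>R a | t a. t \<ge> 0 \<and> a \<in> A}"

definition directionally_fine :: "'a::real_normed_vector set set \<Rightarrow> bool"
  where "directionally_fine \<F> \<longleftrightarrow>
    (\<forall>u\<in>sphere 0 1. \<forall>\<epsilon>\<in>{0<..<1}. \<exists>C\<in>\<F>.
       u \<in> interior C \<and> interior C \<subseteq> C \<and> C \<subseteq> cone_gen (cball u \<epsilon>))"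

definition locally_compact_cone :: "'a::real_normed_vector set \<Rightarrow> bool"
  where "locally_compact_cone L \<longleftrightarrow>
    proper_cone L \<and> (\<forall>x\<in>L. \<exists>r>0. compact (L \<inter> cball x r))"

definition positively_homogeneous :: "('a::real_vector \<Rightarrow> 'b::real_vector) \<Rightarrow> bool"
  where "positively_homogeneous \<Phi> \<longleftrightarrow> (\<forall>t\<ge>0. \<forall>x. \<Phi> (t *\<^sub>R x) = t *\<^sub>R \<Phi> x)"

end

theory Submission
  imports Defs
begin

text \<open>The distance to a closed cone \<open>K\<close> is continuous, positively homogeneous, and vanishes exactly
  on \<open>K\<close>. Local compactness of \<open>L\<close> at the origin makes its unit slice compact, so on \<open>L\<close> the
  distance to \<open>K\<close> is at least a positive multiple of the norm. Subtracting a smaller multiple of the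
  norm keeps it positive on \<open>L\<close> and makes it negative on \<open>K\<close>, away from the origin.\<close>

lemma infdist_scaleR_image:
  fixes x :: "'a::real_normed_vector"
  shows "infdist (c *\<^sub>R x) ((*\<^sub>R) c ` A) = \<bar>c\<bar> * infdist x A"
proof (cases "A = {}")
  case False
  have "(\<lambda>a. dist (c *\<^sub>R x) (c *\<^sub>R a)) ` A = (*) \<bar>c\<bar> ` dist x ` A"
    by (simp add: image_image dist_norm flip: scaleR_diff_right)
  moreover have "mono ((*) \<bar>c\<bar>)"
    by (intro monoI mult_left_mono) auto
  then have "\<bar>c\<bar> * Inf (dist x ` A) = Inf ((*) \<bar>c\<bar> ` dist x ` A)"
    using False by (intro continuous_at_Inf_mono continuous_intros) auto
  ultimately show ?thesis
    using False by (simp add: infdist_notempty image_comp comp_def)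
qed (simp add: infdist_def)

lemma positively_homogeneous_infdist:
  fixes K :: "'a::real_normed_vector set"
  assumes "cone K"
  shows "positively_homogeneous (\<lambda>x. infdist x K)"
  unfolding positively_homogeneous_def
proof (intro allI impI)
  fix t :: real and x :: 'a
  assume "0 \<le> t"
  show "infdist (t *\<^sub>R x) K = t *\<^sub>R infdist x K"
  proof (cases "t = 0 \<or> K = {}")
    case True
    then show ?thesis
      using cone_contains_0[OF assms] by (auto simp: infdist_def[of _ "{}"])
  next
    case False
    then have "(*\<^sub>R) t ` K = K"
      using cone_iff[of K] assms \<open>0 \<le> t\<close> by simp
    then show ?thesis
      using infdist_scaleR_image[of t x K] \<open>0 \<le> t\<close> by simp
  qed
qed

lemma compact_cone_Int_cball:
  fixes L :: "'a::real_normed_vector set"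
  assumes "cone L" "0 < r" "compact (L \<inter> cball 0 r)"
  shows "compact (L \<inter> cball 0 s)"
proof -
  define c where "c = (\<bar>s\<bar> + 1) / r"
  have "0 < c" "s \<le> c * r"
    using assms(2) by (auto simp: c_def)
  have "x \<in> (*\<^sub>R) c ` (L \<inter> cball 0 r)" if "x \<in> L" "norm x \<le> s" for x
  proof (rule image_eqI)
    show "x = c *\<^sub>R (x /\<^sub>R c)"
      using \<open>0 < c\<close> by simp
    show "x /\<^sub>R c \<in> L \<inter> cball 0 r"
      using that \<open>0 < c\<close> \<open>s \<le> c * r\<close> assms(1) by (simp add: mem_cone field_simps)
  qed
  moreover have "(*\<^sub>R) c ` L \<subseteq> L"
    using \<open>0 < c\<close> assms(1) by (auto simp: mem_cone)
  ultimately have "L \<inter> cball 0 s = (*\<^sub>R) c ` (L \<inter> cball 0 r) \<inter> cball 0 s"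
    by auto
  then show ?thesis
    using compact_Int_closed[OF compact_scaling[OF assms(3)] closed_cball] by simp
qed

lemma locally_compact_cone_compact_Int_sphere:
  assumes "locally_compact_cone L"
  shows "compact (L \<inter> sphere 0 s)"
proof -
  have "cone L" "0 \<in> L"
    using assms by (auto simp: locally_compact_cone_def proper_cone_def)
  then obtain r where "0 < r" "compact (L \<inter> cball 0 r)"
    using assms unfolding locally_compact_cone_def by blast
  then have "compact (L \<inter> cball 0 s)"
    by (rule compact_cone_Int_cball[OF \<open>cone L\<close>])
  then have "compact (L \<inter> cball 0 s - ball 0 s)"
    by (rule compact_diff) (rule open_ball)
  moreover have "L \<inter> cball 0 s - ball 0 s = L \<inter> sphere 0 s"
    using cball_diff_eq_sphere by blast
  ultimately show ?thesis
    by simp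
qed

lemma positively_homogeneous_ge_norm_on_cone:
  fixes f :: "'a::real_normed_vector \<Rightarrow> real"
  assumes "cone L" and "compact (L \<inter> sphere 0 1)"
    and "continuous_on (L \<inter> sphere 0 1) f" and hom: "positively_homogeneous f"
    and pos: "\<And>x. x \<in> L \<Longrightarrow> x \<noteq> 0 \<Longrightarrow> 0 < f x"
  obtains \<delta> where "0 < \<delta>" "\<And>x. x \<in> L \<Longrightarrow> \<delta> * norm x \<le> f x"
proof -
  obtain \<delta> where "0 < \<delta>" and slice: "\<And>u. u \<in> L \<inter> sphere 0 1 \<Longrightarrow> \<delta> \<le> f u"
  proof (cases "L \<inter> sphere 0 1 = {}")
    case False
    then obtain m where m: "m \<in> L \<inter> sphere 0 1" "\<And>u. u \<in> L \<inter> sphere 0 1 \<Longrightarrow> f m \<le> f u"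
      using continuous_attains_inf[of "L \<inter> sphere 0 1" f] assms(2,3) by blast
    then have "m \<in> L" "m \<noteq> 0"
      by auto
    then have "0 < f m"
      by (rule pos)
    with m(2) show ?thesis
      using that by blast
  qed (auto intro: that[of 1])
  have "\<delta> * norm x \<le> f x" if "x \<in> L" for x
  proof (cases "x = 0")
    case True
    have "f (0 *\<^sub>R x) = 0 *\<^sub>R f x"
      using hom unfolding positively_homogeneous_def by blast
    with True show ?thesis
      by simp
  next
    case False
    then have "\<delta> \<le> f (x /\<^sub>R norm x)"
      using that assms(1) by (intro slice) (simp add: mem_cone)
    also have "\<dots> = f x / norm x"
      using hom by (simp add: positively_homogeneous_def divide_inverse_commute)
    finally show ?thesis
      using False by (simp add: field_simps)
  qed
  with \<open>0 < \<delta>\<close> show ?thesis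
    by (rule that)
qed

lemma locally_compact_cone_infdist_ge_norm:
  assumes "locally_compact_cone L" "cone K" "closed K" "L \<inter> K = {0}"
  obtains \<delta> where "0 < \<delta>" "\<And>l. l \<in> L \<Longrightarrow> \<delta> * norm l \<le> infdist l K"
proof (rule positively_homogeneous_ge_norm_on_cone)
  show "cone L"
    using assms(1) by (simp add: locally_compact_cone_def proper_cone_def)
  show "compact (L \<inter> sphere 0 1)"
    by (rule locally_compact_cone_compact_Int_sphere[OF assms(1)])
  show "continuous_on (L \<inter> sphere 0 1) (\<lambda>x. infdist x K)"
    by (intro continuous_intros)
  show "positively_homogeneous (\<lambda>x. infdist x K)"
    by (rule positively_homogeneous_infdist[OF assms(2)])
  show "0 < infdist l K" if "l \<in> L" "l \<noteq> 0" for l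
    using that assms(3,4) by (intro infdist_pos_not_in_closed) auto
qed (rule that)

definition cone_separator :: "'a::real_normed_vector set \<Rightarrow> real \<Rightarrow> 'a \<Rightarrow> real"
  where "cone_separator K \<gamma> x = infdist x K - \<gamma> * norm x"

lemma continuous_on_cone_separator: "continuous_on S (cone_separator K \<gamma>)"
  unfolding cone_separator_def by (intro continuous_intros)

lemma positively_homogeneous_cone_separator:
  assumes "cone K"
  shows "positively_homogeneous (cone_separator K \<gamma>)"
  using positively_homogeneous_infdist[OF assms]
  by (simp add: positively_homogeneous_def cone_separator_def right_diff_distrib)

lemma abs_cone_separator_le_norm:
  assumes "0 \<in> K" "0 \<le> \<gamma>" "\<gamma> \<le> 1"
  shows "\<bar>cone_separator K \<gamma> x\<bar> \<le> norm x"
proof -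
  have "0 \<le> infdist x K" "infdist x K \<le> norm x"
    using infdist_nonneg infdist_le[OF assms(1), of x] by auto
  moreover have "0 \<le> \<gamma> * norm x" "\<gamma> * norm x \<le> norm x"
    using assms(2,3) by (auto intro: mult_left_le_one_le)
  ultimately show ?thesis
    unfolding cone_separator_def by linarith
qed

theorem corollary3p24:
  fixes \<F> :: "'a::real_normed_vector set set" and L K :: "'a set"
  assumes "\<And>C. C \<in> \<F> \<Longrightarrow> proper_cone C \<and> closed C"
    and "directionally_fine \<F>"
    and "proper_cone L" and "proper_cone K"
    and "L \<inter> K = {0}"
    and "closed K"
    and "locally_compact_cone L"
  shows "\<exists>(\<Phi> :: 'a \<Rightarrow> real) \<gamma>\<^sub>L. continuous_on UNIV \<Phi> \<and> positively_homogeneous \<Phi> \<and> \<gamma>\<^sub>L > 0 \<and>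
    (\<forall>x. \<bar>\<Phi> x\<bar> \<le> norm x) \<and>
    (\<forall>l\<in>L - {0}. \<forall>k\<in>K - {0}.
       \<Phi> l \<ge> \<gamma>\<^sub>L * norm l \<and> \<gamma>\<^sub>L * norm l > 0 \<and> 0 > \<Phi> k)"
proof -
  have "cone K" "0 \<in> K"
    using assms(4) by (auto simp: proper_cone_def)
  obtain \<delta> where "0 < \<delta>" and \<delta>: "\<And>l. l \<in> L \<Longrightarrow> \<delta> * norm l \<le> infdist l K"
    using locally_compact_cone_infdist_ge_norm[OF assms(7) \<open>cone K\<close> assms(6,5)] by blast
  define \<gamma> where "\<gamma> = min 1 (\<delta> / 2)"
  have "0 < \<gamma>" "\<gamma> \<le> 1" "2 * \<gamma> \<le> \<delta>"
    using \<open>0 < \<delta>\<close> by (auto simp: \<gamma>_def)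
  have "\<gamma> * norm l \<le> cone_separator K \<gamma> l" if "l \<in> L" for l
    using mult_right_mono[OF \<open>2 * \<gamma> \<le> \<delta>\<close>, of "norm l"] \<delta>[OF that]
    by (simp add: cone_separator_def)
  moreover have "cone_separator K \<gamma> k < 0" if "k \<in> K" "k \<noteq> 0" for k
    using that \<open>0 < \<gamma>\<close> by (simp add: cone_separator_def)
  moreover have "\<bar>cone_separator K \<gamma> x\<bar> \<le> norm x" for x
    using \<open>0 \<in> K\<close> \<open>0 < \<gamma>\<close> \<open>\<gamma> \<le> 1\<close> by (intro abs_cone_separator_le_norm) auto
  ultimately show ?thesis
    using continuous_on_cone_separator positively_homogeneous_cone_separator[OF \<open>cone K\<close>] \<open>0 < \<gamma>\<close>
    by (intro exI[of _ "cone_separator K \<gamma>"] exI[of _ \<gamma>]) auto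
qed

end
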